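(* Let $k$ be an uncountable algebraically closed field. Let $X = \varinjlim X_n$ be an affine ind-variety over $k$ such that every point $x \in X$ has a Zariski open neighbourhood $U_x \subseteq X$ (i.e. open with respect to the Zariski topology on $X$) with $U_x \cap X_n = U_x \cap X_{n+1}$ for all sufficiently large $n$. Then the ind-topology and the Zariski topology on $X$ coincide.
   Context: Affine varieties over $k$ are reduced, of finite type, and not necessarily irreducible. An affine ind-variety $X = \varinjlim X_n$ is given by a filtration, i.e. a countable sequence of closed embeddings of affine varieties $X_1 \hookrightarrow X_2 \hookrightarrow X_3 \hookrightarrow \cdots$. As a set, $X = \bigcup_{n} X_n$, and its ring of regular functions is $\mathcal{O}(X) = \varprojlim \mathcal{O}(X_n)$ (transition maps are restrictions), with the topology induced from the product topology of $\prod_n \mathcal{O}(X_n)$, each $\mathcal{O}(X_n)$ being discrete. Two topologies on $X$: in the ind-topology, a subset $Y \subseteq X$ is closed iff $Y \cap X_n$ is Zariski closed in the variety $X_n$ for every $n$. In the Zariski topology, the closed subsets of $X$ are the common zero sets in $X$ of subsets $E \subseteq \mathcal{O}(X)$. *)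

theory Defs
  imports
    "HOL-Analysis.Abstract_Topology"
    "HOL-Library.Poly_Mapping"
    "HOL-Library.Countable_Set"
    "HOL-Computational_Algebra.Polynomial"
begin

section \<open>Affine varieties\<close>

text \<open>
  A polynomial is a finitely supported function from monomials to coefficients, a monomial being a
  finitely supported function from variable indices to exponents. The points of affine
  \<open>m\<close>-space are the functions in \<open>{..<m} \<rightarrow>\<^sub>E UNIV\<close>.
\<close>

type_synonym 'k mpoly = "(nat \<Rightarrow>\<^sub>0 nat) \<Rightarrow>\<^sub>0 'k"

definition mpolys :: "nat \<Rightarrow> 'k::zero mpoly set" where
  "mpolys m = {p. \<forall>\<mu>\<in>Poly_Mapping.keys p. Poly_Mapping.keys \<mu> \<subseteq> {..<m}}"

definition monom_eval :: "(nat \<Rightarrow> 'k::comm_semiring_1) \<Rightarrow> (nat \<Rightarrow>\<^sub>0 nat) \<Rightarrow> 'k" where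
  "monom_eval a \<mu> = (\<Prod>i\<in>Poly_Mapping.keys \<mu>. a i ^ Poly_Mapping.lookup \<mu> i)"

definition mpoly_eval :: "(nat \<Rightarrow> 'k::comm_semiring_1) \<Rightarrow> 'k mpoly \<Rightarrow> 'k" where
  "mpoly_eval a p = (\<Sum>\<mu>\<in>Poly_Mapping.keys p. Poly_Mapping.lookup p \<mu> * monom_eval a \<mu>)"

definition algebraic_set :: "nat \<Rightarrow> (nat \<Rightarrow> 'k::field) set \<Rightarrow> bool" where
  "algebraic_set m Z \<longleftrightarrow>
     (\<exists>P\<subseteq>mpolys m. Z = {a \<in> {..<m} \<rightarrow>\<^sub>E UNIV. \<forall>p\<in>P. mpoly_eval a p = 0})"

text \<open>
  A variety is given by its set \<open>V\<close> of (closed) points and its ring \<open>R\<close> of regular functions, the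
  latter being \<open>k\<close>-valued functions that are \<open>undefined\<close> outside \<open>V\<close>. It is affine if some
  \<open>\<phi>\<close> identifies it with an algebraic set together with its ring of polynomial functions.
\<close>

definition affine_variety :: "'x set \<Rightarrow> ('x \<Rightarrow> 'k::alg_closed_field) set \<Rightarrow> bool" where
  "affine_variety V R \<longleftrightarrow>
     (\<exists>m Z \<phi>. algebraic_set m Z \<and> bij_betw \<phi> V Z \<and>
        R = (\<lambda>p. restrict (\<lambda>x. mpoly_eval (\<phi> x) p) V) ` mpolys m)"

definition zariski_closed :: "'x set \<Rightarrow> ('x \<Rightarrow> 'k::zero) set \<Rightarrow> 'x set \<Rightarrow> bool" where
  "zariski_closed V R C \<longleftrightarrow> (\<exists>E\<subseteq>R. C = {x\<in>V. \<forall>f\<in>E. f x = 0})"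

text \<open>
  \<open>\<iota>\<close> is a closed embedding if it is an isomorphism of \<open>V\<close> onto the closed subvariety
  \<open>\<iota> ` V\<close> of \<open>W\<close>, whose regular functions are the restrictions of those of \<open>W\<close>.
\<close>

definition closed_embedding ::
    "('x \<Rightarrow> 'y) \<Rightarrow> 'x set \<Rightarrow> ('x \<Rightarrow> 'k::field) set \<Rightarrow> 'y set \<Rightarrow> ('y \<Rightarrow> 'k) set \<Rightarrow> bool" where
  "closed_embedding \<iota> V R W S \<longleftrightarrow>
     inj_on \<iota> V \<and> zariski_closed W S (\<iota> ` V) \<and> R = (\<lambda>f. restrict (f \<circ> \<iota>) V) ` S"


section \<open>Affine ind-varieties\<close>

text \<open>
  The points of the ind-variety are \<open>\<Union>n. X n\<close>, so each \<open>X n\<close> is identified with its image in the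
  limit and the embeddings are inclusions. \<open>R n\<close> is the ring of regular functions of \<open>X n\<close>.
\<close>

locale affine_ind_variety =
  fixes X :: "nat \<Rightarrow> 'x set" and R :: "nat \<Rightarrow> ('x \<Rightarrow> 'k::alg_closed_field) set"
  assumes affine: "affine_variety (X n) (R n)"
    and embedding: "closed_embedding (\<lambda>x. x) (X n) (R n) (X (Suc n)) (R (Suc n))"

text \<open>The inverse limit of the rings \<open>R n\<close> along the restriction maps.\<close>

definition ind_regular :: "(nat \<Rightarrow> 'x set) \<Rightarrow> (nat \<Rightarrow> ('x \<Rightarrow> 'k) set) \<Rightarrow> (nat \<Rightarrow> 'x \<Rightarrow> 'k) set" where
  "ind_regular X R = {F. \<forall>n. F n \<in> R n \<and> restrict (F (Suc n)) (X n) = F n}"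

text \<open>
  The value at \<open>x\<close> of an element of the inverse limit; by compatibility any \<open>n\<close> with
  \<open>x \<in> X n\<close> gives the same result.
\<close>

definition ind_value :: "(nat \<Rightarrow> 'x set) \<Rightarrow> (nat \<Rightarrow> 'x \<Rightarrow> 'k) \<Rightarrow> 'x \<Rightarrow> 'k" where
  "ind_value X F x = F (LEAST n. x \<in> X n) x"

definition ind_closed :: "(nat \<Rightarrow> 'x set) \<Rightarrow> (nat \<Rightarrow> ('x \<Rightarrow> 'k::zero) set) \<Rightarrow> 'x set \<Rightarrow> bool" where
  "ind_closed X R Y \<longleftrightarrow> Y \<subseteq> (\<Union>n. X n) \<and> (\<forall>n. zariski_closed (X n) (R n) (Y \<inter> X n))"

definition ind_zariski_closed ::
    "(nat \<Rightarrow> 'x set) \<Rightarrow> (nat \<Rightarrow> ('x \<Rightarrow> 'k::zero) set) \<Rightarrow> 'x set \<Rightarrow> bool" where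
  "ind_zariski_closed X R Y \<longleftrightarrow>
     (\<exists>E\<subseteq>ind_regular X R. Y = {x \<in> (\<Union>n. X n). \<forall>F\<in>E. ind_value X F x = 0})"

definition ind_topology :: "(nat \<Rightarrow> 'x set) \<Rightarrow> (nat \<Rightarrow> ('x \<Rightarrow> 'k::zero) set) \<Rightarrow> 'x topology" where
  "ind_topology X R = topology (\<lambda>U. U \<subseteq> (\<Union>n. X n) \<and> ind_closed X R ((\<Union>n. X n) - U))"

definition zariski_topology :: "(nat \<Rightarrow> 'x set) \<Rightarrow> (nat \<Rightarrow> ('x \<Rightarrow> 'k::zero) set) \<Rightarrow> 'x topology" where
  "zariski_topology X R =
     topology (\<lambda>U. U \<subseteq> (\<Union>n. X n) \<and> ind_zariski_closed X R ((\<Union>n. X n) - U))"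


section \<open>The closed sets of the two topologies\<close>

lemma monom_eval_superset:
  assumes "finite A" "Poly_Mapping.keys \<mu> \<subseteq> A"
  shows "monom_eval a \<mu> = (\<Prod>i\<in>A. a i ^ Poly_Mapping.lookup \<mu> i)"
  unfolding monom_eval_def
  by (rule prod.mono_neutral_left) (use assms in \<open>auto simp: in_keys_iff\<close>)

lemma monom_eval_add: "monom_eval a (\<mu> + \<nu>) = monom_eval a \<mu> * monom_eval a \<nu>"
proof -
  let ?A = "Poly_Mapping.keys \<mu> \<union> Poly_Mapping.keys \<nu>"
  have "monom_eval a (\<mu> + \<nu>) = (\<Prod>i\<in>?A. a i ^ Poly_Mapping.lookup (\<mu> + \<nu>) i)"
    by (rule monom_eval_superset) (auto simp: in_keys_iff lookup_add)
  also have "\<dots> = (\<Prod>i\<in>?A. a i ^ Poly_Mapping.lookup \<mu> i) * (\<Prod>i\<in>?A. a i ^ Poly_Mapping.lookup \<nu> i)"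
    by (simp add: lookup_add power_add prod.distrib)
  also have "\<dots> = monom_eval a \<mu> * monom_eval a \<nu>"
    by (subst (1 2) monom_eval_superset[where A = ?A]) auto
  finally show ?thesis .
qed

lemma mpoly_eval_0 [simp]: "mpoly_eval a 0 = 0"
  by (simp add: mpoly_eval_def)

lemma mpoly_eval_add: "mpoly_eval a (p + q) = mpoly_eval a p + mpoly_eval a q"
  unfolding mpoly_eval_def
  by (rule setsum_keys_plus_distrib) (auto simp: algebra_simps)

lemma mpoly_eval_single: "mpoly_eval a (Poly_Mapping.single \<mu> c) = c * monom_eval a \<mu>"
  by (cases "c = 0") (auto simp: mpoly_eval_def)

lemma mpoly_eval_1 [simp]: "mpoly_eval a 1 = 1"
  by (simp add: mpoly_eval_def monom_eval_def)

lemma mpoly_eval_sum: "mpoly_eval a (sum f A) = (\<Sum>i\<in>A. mpoly_eval a (f i))"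
  by (induction A rule: infinite_finite_induct) (auto simp: mpoly_eval_add)

lemma mpoly_as_sum:
  fixes p :: "'k::comm_monoid_add mpoly"
  shows "p = (\<Sum>\<mu>\<in>Poly_Mapping.keys p. Poly_Mapping.single \<mu> (Poly_Mapping.lookup p \<mu>))"
proof (rule poly_mapping_eqI)
  fix \<nu>
  show "Poly_Mapping.lookup p \<nu> = Poly_Mapping.lookup
          (\<Sum>\<mu>\<in>Poly_Mapping.keys p. Poly_Mapping.single \<mu> (Poly_Mapping.lookup p \<mu>)) \<nu>"
    by (auto simp: lookup_sum lookup_single when_def in_keys_iff)
qed

lemma mpoly_eval_mult: "mpoly_eval a (p * q) = mpoly_eval a p * mpoly_eval a q"
proof -
  have "p * q = (\<Sum>\<mu>\<in>Poly_Mapping.keys p. \<Sum>\<nu>\<in>Poly_Mapping.keys q.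
      Poly_Mapping.single (\<mu> + \<nu>) (Poly_Mapping.lookup p \<mu> * Poly_Mapping.lookup q \<nu>))"
    by (subst mpoly_as_sum[of p], subst mpoly_as_sum[of q])
       (simp add: sum_product mult_single)
  then show ?thesis
    by (simp add: mpoly_eval_sum mpoly_eval_single monom_eval_add)
       (simp add: mpoly_eval_def sum_product mult_ac)
qed

lemma one_in_mpolys: "(1 :: 'k::comm_semiring_1 mpoly) \<in> mpolys m"
  by (auto simp: mpolys_def)

lemma mult_in_mpolys:
  fixes p q :: "'k::comm_semiring_1 mpoly"
  assumes "p \<in> mpolys m" "q \<in> mpolys m"
  shows "p * q \<in> mpolys m"
  unfolding mpolys_def
proof (intro CollectI ballI)
  fix \<rho> assume "\<rho> \<in> Poly_Mapping.keys (p * q)"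
  then obtain \<mu> \<nu> where *: "\<rho> = \<mu> + \<nu>" "\<mu> \<in> Poly_Mapping.keys p" "\<nu> \<in> Poly_Mapping.keys q"
    using keys_mult[of p q] by blast
  then show "Poly_Mapping.keys \<rho> \<subseteq> {..<m}"
    using assms keys_add[of \<mu> \<nu>] unfolding mpolys_def by blast
qed

lemma affine_variety_one:
  assumes "affine_variety V R"
  shows "restrict (\<lambda>x. 1) V \<in> R"
proof -
  obtain m \<phi> where R: "R = (\<lambda>p. restrict (\<lambda>x. mpoly_eval (\<phi> x) p) V) ` mpolys m"
    using assms unfolding affine_variety_def by blast
  show ?thesis
    unfolding R by (rule image_eqI[OF _ one_in_mpolys]) simp
qed

lemma affine_variety_mult:
  assumes "affine_variety V R" "f \<in> R" "g \<in> R"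
  shows "restrict (\<lambda>x. f x * g x) V \<in> R"
proof -
  obtain m \<phi> where R: "R = (\<lambda>p. restrict (\<lambda>x. mpoly_eval (\<phi> x) p) V) ` mpolys m"
    using assms(1) unfolding affine_variety_def by blast
  obtain p q where "p \<in> mpolys m" "q \<in> mpolys m"
    "f = restrict (\<lambda>x. mpoly_eval (\<phi> x) p) V" "g = restrict (\<lambda>x. mpoly_eval (\<phi> x) q) V"
    using assms(2,3) unfolding R by blast
  then show ?thesis
    unfolding R by (intro image_eqI[where x = "p * q"]) (auto simp: mpoly_eval_mult mult_in_mpolys)
qed

lemma affine_variety_extensional: "affine_variety V R \<Longrightarrow> f \<in> R \<Longrightarrow> restrict f V = f"
  unfolding affine_variety_def by auto

lemma zariski_closed_Un:
  assumes "affine_variety V R" "zariski_closed V R C" "zariski_closed V R D"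
  shows "zariski_closed V R (C \<union> D)"
proof -
  obtain E G where EG: "E \<subseteq> R" "C = {x\<in>V. \<forall>f\<in>E. f x = 0}" "G \<subseteq> R" "D = {x\<in>V. \<forall>f\<in>G. f x = 0}"
    using assms unfolding zariski_closed_def by auto
  let ?H = "(\<lambda>(f, g). restrict (\<lambda>x. f x * g x) V) ` (E \<times> G)"
  have "?H \<subseteq> R"
    using affine_variety_mult[OF assms(1)] EG by auto
  moreover have "C \<union> D = {x\<in>V. \<forall>f\<in>?H. f x = 0}"
    unfolding EG by auto
  ultimately show ?thesis unfolding zariski_closed_def by blast
qed

lemma zariski_closed_empty: "affine_variety V R \<Longrightarrow> zariski_closed V R {}"
  unfolding zariski_closed_def
  by (rule exI[where x = "{restrict (\<lambda>x. 1) V}"]) (auto simp: affine_variety_one)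

lemma zariski_closed_INT:
  assumes "\<And>i. i \<in> I \<Longrightarrow> zariski_closed V R (C i)"
  shows "zariski_closed V R (V \<inter> (\<Inter>i\<in>I. C i))"
proof -
  have "\<forall>i\<in>I. \<exists>E. E \<subseteq> R \<and> C i = {x\<in>V. \<forall>f\<in>E. f x = 0}"
    using assms unfolding zariski_closed_def by simp
  from bchoice[OF this] obtain E where
    E: "\<forall>i\<in>I. E i \<subseteq> R \<and> C i = {x\<in>V. \<forall>f\<in>E i. f x = 0}" ..
  have "(\<Inter>i\<in>I. C i) = (\<Inter>i\<in>I. {x\<in>V. \<forall>f\<in>E i. f x = 0})"
    by (rule INF_cong[OF refl E[rule_format, THEN conjunct2]])
  then have "V \<inter> (\<Inter>i\<in>I. C i) = {x\<in>V. \<forall>f\<in>(\<Union>i\<in>I. E i). f x = 0}"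
    by auto
  moreover have "(\<Union>i\<in>I. E i) \<subseteq> R"
    by (rule UN_least) (rule E[rule_format, THEN conjunct1])
  ultimately show ?thesis
    unfolding zariski_closed_def by (intro exI conjI)
qed

context affine_ind_variety
begin

lemma X_mono: "m \<le> n \<Longrightarrow> X m \<subseteq> X n"
proof (rule lift_Suc_mono_le[of X])
  show "X n \<subseteq> X (Suc n)" for n
    using embedding[of n] unfolding closed_embedding_def zariski_closed_def by auto
qed

lemma ind_regular_le:
  assumes F: "F \<in> ind_regular X R" and "x \<in> X m" "m \<le> n"
  shows "F n x = F m x"
  using \<open>m \<le> n\<close>
proof (induction rule: dec_induct)
  case (step n)
  have "x \<in> X n" using X_mono[OF step(1)] assms by auto
  moreover have "restrict (F (Suc n)) (X n) = F n" using F by (auto simp: ind_regular_def)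
  ultimately have "F (Suc n) x = F n x" by (metis (full_types) restrict_apply')
  then show ?case using step by simp
qed simp

lemma ind_value_eq:
  assumes "F \<in> ind_regular X R" "x \<in> X n"
  shows "ind_value X F x = F n x"
  unfolding ind_value_def
  by (rule ind_regular_le[OF assms(1), symmetric])
     (use assms(2) in \<open>auto intro: LeastI Least_le\<close>)

lemma ind_regular_one: "(\<lambda>n. restrict (\<lambda>x. 1) (X n)) \<in> ind_regular X R"
  using affine_variety_one[OF affine] X_mono[of n "Suc n" for n]
  by (auto simp: ind_regular_def fun_eq_iff)

lemma ind_regular_mult:
  assumes F: "F \<in> ind_regular X R" and G: "G \<in> ind_regular X R"
  shows "(\<lambda>n. restrict (\<lambda>x. F n x * G n x) (X n)) \<in> ind_regular X R"
proof -
  have "restrict (\<lambda>x. F n x * G n x) (X n) \<in> R n" for n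
    using F G affine_variety_mult[OF affine] by (auto simp: ind_regular_def)
  moreover have "x \<in> X (Suc n)" if "x \<in> X n" for n x
    using X_mono[of n "Suc n"] that by auto
  ultimately show ?thesis
    using ind_regular_le[OF F _ le_SucI[OF order_refl]] ind_regular_le[OF G _ le_SucI[OF order_refl]]
    unfolding ind_regular_def by (auto simp: fun_eq_iff)
qed

lemma istopology_ind: "istopology (\<lambda>U. U \<subseteq> (\<Union>n. X n) \<and> ind_closed X R ((\<Union>n. X n) - U))"
  unfolding istopology_def
proof (intro conjI allI impI)
  fix S T
  assume S: "S \<subseteq> (\<Union>n. X n) \<and> ind_closed X R ((\<Union>n. X n) - S)"
    and T: "T \<subseteq> (\<Union>n. X n) \<and> ind_closed X R ((\<Union>n. X n) - T)"
  show "S \<inter> T \<subseteq> (\<Union>n. X n)" using S by blast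
  have eq: "((\<Union>n. X n) - S \<inter> T) \<inter> X n = ((\<Union>n. X n) - S) \<inter> X n \<union> ((\<Union>n. X n) - T) \<inter> X n" for n
    by blast
  show "ind_closed X R ((\<Union>n. X n) - S \<inter> T)"
    using S T zariski_closed_Un[OF affine] unfolding ind_closed_def eq by auto
next
  fix \<K>
  assume *: "\<forall>K\<in>\<K>. K \<subseteq> (\<Union>n. X n) \<and> ind_closed X R ((\<Union>n. X n) - K)"
  then show "\<Union>\<K> \<subseteq> (\<Union>n. X n)" by blast
  have eq: "((\<Union>n. X n) - \<Union>\<K>) \<inter> X n = X n \<inter> (\<Inter>K\<in>\<K>. ((\<Union>n. X n) - K) \<inter> X n)" for n
    by blast
  show "ind_closed X R ((\<Union>n. X n) - \<Union>\<K>)"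
    unfolding ind_closed_def
  proof (intro conjI allI)
    fix n
    have "zariski_closed (X n) (R n) (X n \<inter> (\<Inter>K\<in>\<K>. ((\<Union>n. X n) - K) \<inter> X n))"
      by (rule zariski_closed_INT) (use * in \<open>auto simp: ind_closed_def\<close>)
    then show "zariski_closed (X n) (R n) (((\<Union>n. X n) - \<Union>\<K>) \<inter> X n)"
      unfolding eq .
  qed blast
qed

lemma istopology_zariski:
  "istopology (\<lambda>U. U \<subseteq> (\<Union>n. X n) \<and> ind_zariski_closed X R ((\<Union>n. X n) - U))"
  unfolding istopology_def
proof (intro conjI allI impI)
  fix S T
  assume S: "S \<subseteq> (\<Union>n. X n) \<and> ind_zariski_closed X R ((\<Union>n. X n) - S)"
    and T: "T \<subseteq> (\<Union>n. X n) \<and> ind_zariski_closed X R ((\<Union>n. X n) - T)"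
  show "S \<inter> T \<subseteq> (\<Union>n. X n)" using S by blast
  obtain E G where E: "E \<subseteq> ind_regular X R"
      "(\<Union>n. X n) - S = {x \<in> (\<Union>n. X n). \<forall>F\<in>E. ind_value X F x = 0}"
    and G: "G \<subseteq> ind_regular X R"
      "(\<Union>n. X n) - T = {x \<in> (\<Union>n. X n). \<forall>F\<in>G. ind_value X F x = 0}"
    using S T unfolding ind_zariski_closed_def by auto
  define pr where "pr = (\<lambda>F G n. restrict (\<lambda>x. F n x * G n x) (X n) :: 'x \<Rightarrow> 'k)"
  have pr: "pr F H \<in> ind_regular X R" if "F \<in> E" "H \<in> G" for F H
    using ind_regular_mult that E(1) G(1) unfolding pr_def by blast
  have val: "ind_value X (pr F H) x = ind_value X F x * ind_value X H x"
    if x: "x \<in> (\<Union>n. X n)" and F: "F \<in> E" and H: "H \<in> G" for F H x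
  proof -
    obtain n where n: "x \<in> X n" using x by blast
    have "F \<in> ind_regular X R" "H \<in> ind_regular X R" using F H E(1) G(1) by auto
    then show ?thesis
      using n pr[OF F H] by (simp add: ind_value_eq[of _ x n]) (simp add: pr_def)
  qed
  let ?H = "(\<lambda>(F, H). pr F H) ` (E \<times> G)"
  have "?H \<subseteq> ind_regular X R" using pr by auto
  moreover have "(\<Union>n. X n) - S \<inter> T = {x \<in> (\<Union>n. X n). \<forall>F\<in>?H. ind_value X F x = 0}"
  proof -
    have "(\<Union>n. X n) - S \<inter> T = ((\<Union>n. X n) - S) \<union> ((\<Union>n. X n) - T)" by blast
    also have "\<dots> = {x \<in> (\<Union>n. X n). \<forall>F\<in>E. \<forall>H\<in>G. ind_value X F x * ind_value X H x = 0}"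
      unfolding E(2) G(2) by auto
    also have "\<dots> = {x \<in> (\<Union>n. X n). \<forall>F\<in>?H. ind_value X F x = 0}"
      using val by (intro Collect_cong conj_cong refl) auto
    finally show ?thesis .
  qed
  ultimately show "ind_zariski_closed X R ((\<Union>n. X n) - S \<inter> T)"
    unfolding ind_zariski_closed_def by blast
next
  fix \<K>
  assume *: "\<forall>K\<in>\<K>. K \<subseteq> (\<Union>n. X n) \<and> ind_zariski_closed X R ((\<Union>n. X n) - K)"
  then show "\<Union>\<K> \<subseteq> (\<Union>n. X n)" by blast
  have "\<forall>K\<in>\<K>. \<exists>E. E \<subseteq> ind_regular X R \<and>
      (\<Union>n. X n) - K = {x \<in> (\<Union>n. X n). \<forall>F\<in>E. ind_value X F x = 0}"
    using * unfolding ind_zariski_closed_def by fast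
  from bchoice[OF this] obtain E where E: "\<forall>K\<in>\<K>. E K \<subseteq> ind_regular X R \<and>
      (\<Union>n. X n) - K = {x \<in> (\<Union>n. X n). \<forall>F\<in>E K. ind_value X F x = 0}" ..
  have "(\<Union>n. X n) - \<Union>\<K> = (\<Union>n. X n) \<inter> (\<Inter>K\<in>\<K>. (\<Union>n. X n) - K)" by blast
  also have "(\<Inter>K\<in>\<K>. (\<Union>n. X n) - K) =
      (\<Inter>K\<in>\<K>. {x \<in> (\<Union>n. X n). \<forall>F\<in>E K. ind_value X F x = 0})"
    by (rule INF_cong[OF refl E[rule_format, THEN conjunct2]])
  also have "(\<Union>n. X n) \<inter> \<dots> = {x \<in> (\<Union>n. X n). \<forall>F\<in>(\<Union>K\<in>\<K>. E K). ind_value X F x = 0}"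
    by auto
  finally have "(\<Union>n. X n) - \<Union>\<K> = {x \<in> (\<Union>n. X n). \<forall>F\<in>(\<Union>K\<in>\<K>. E K). ind_value X F x = 0}" .
  moreover have "(\<Union>K\<in>\<K>. E K) \<subseteq> ind_regular X R"
    by (rule UN_least) (rule E[rule_format, THEN conjunct1])
  ultimately show "ind_zariski_closed X R ((\<Union>n. X n) - \<Union>\<K>)"
    unfolding ind_zariski_closed_def by (intro exI conjI)
qed

lemma openin_ind_topology:
  "openin (ind_topology X R) U \<longleftrightarrow> U \<subseteq> (\<Union>n. X n) \<and> ind_closed X R ((\<Union>n. X n) - U)"
  unfolding ind_topology_def by (simp add: topology_inverse'[OF istopology_ind])

lemma openin_zariski_topology:
  "openin (zariski_topology X R) U \<longleftrightarrow> U \<subseteq> (\<Union>n. X n) \<and> ind_zariski_closed X R ((\<Union>n. X n) - U)"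
  unfolding zariski_topology_def by (simp add: topology_inverse'[OF istopology_zariski])

lemma topspace_ind_topology: "topspace (ind_topology X R) = (\<Union>n. X n)"
proof -
  have "openin (ind_topology X R) (\<Union>n. X n)"
    by (auto simp: openin_ind_topology ind_closed_def zariski_closed_empty[OF affine])
  moreover have "topspace (ind_topology X R) \<subseteq> (\<Union>n. X n)"
    using openin_topspace[of "ind_topology X R"] unfolding openin_ind_topology by (rule conjunct1)
  ultimately show ?thesis
    by (intro subset_antisym openin_subset)
qed

lemma topspace_zariski_topology: "topspace (zariski_topology X R) = (\<Union>n. X n)"
proof -
  define one where "one = (\<lambda>n. restrict (\<lambda>x. 1 :: 'k) (X n))"
  have one: "one \<in> ind_regular X R"
    unfolding one_def by (rule ind_regular_one)
  have "ind_value X one x \<noteq> 0" if "x \<in> X n" for x n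
    using ind_value_eq[OF one that] that by (simp add: one_def)
  then have "{} = {x \<in> (\<Union>n. X n). \<forall>F\<in>{one}. ind_value X F x = 0}"
    by blast
  moreover have "{one} \<subseteq> ind_regular X R"
    using one by simp
  ultimately have "ind_zariski_closed X R {}"
    unfolding ind_zariski_closed_def by (intro exI conjI)
  then have "openin (zariski_topology X R) (\<Union>n. X n)"
    by (simp add: openin_zariski_topology)
  moreover have "topspace (zariski_topology X R) \<subseteq> (\<Union>n. X n)"
    using openin_topspace[of "zariski_topology X R"] unfolding openin_zariski_topology by (rule conjunct1)
  ultimately show ?thesis
    by (intro subset_antisym openin_subset)
qed

lemma closedin_ind_topology: "closedin (ind_topology X R) Y \<longleftrightarrow> ind_closed X R Y"
  unfolding closedin_def topspace_ind_topology openin_ind_topology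
  by (auto simp: double_diff ind_closed_def)

lemma closedin_zariski_topology: "closedin (zariski_topology X R) Y \<longleftrightarrow> ind_zariski_closed X R Y"
proof -
  have "Y \<subseteq> (\<Union>n. X n)" if "ind_zariski_closed X R Y"
    using that unfolding ind_zariski_closed_def by blast
  then show ?thesis
    unfolding closedin_def topspace_zariski_topology openin_zariski_topology
    by (auto simp: double_diff)
qed

end

end

theory Submission
  imports Defs
begin

text \<open>
  Evaluating a compatible family on \<open>X n\<close> only involves its \<open>n\<close>-th member, so Zariski closed sets
  are always closed in the ind-topology. Conversely, an ind-closed set \<open>Y\<close> is Zariski closed as
  soon as every point \<open>x\<close> outside \<open>Y\<close> is separated from \<open>Y\<close> by a global regular function.

  The hypothesis supplies such functions. The neighbourhood of \<open>x\<close> contains a principal open set,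
  the locus where some global function \<open>F\<close> with \<open>F x \<noteq> 0\<close> does not vanish; since the neighbourhood
  stops growing, this locus lies in a single variety \<open>X N\<close>. On \<open>X N\<close> there is a regular function
  \<open>h\<close> that vanishes on \<open>Y \<inter> X N\<close> but not at \<open>x\<close>. Restriction along a closed embedding is
  surjective on regular functions, so \<open>h\<close> extends to a global function \<open>H\<close>
  (\<open>ind_regular_extension\<close>). Nothing is known about \<open>H\<close> on \<open>Y\<close> outside \<open>X N\<close>, but there \<open>F\<close>
  vanishes; hence the product \<open>F * H\<close> vanishes on all of \<open>Y\<close> and is nonzero at \<open>x\<close>
  (\<open>separating_function\<close>).
\<close>

context affine_ind_variety
begin

lemma restrict_regular:
  assumes "f \<in> R n" "m \<le> n"
  shows "restrict f (X m) \<in> R m"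
  using assms(2,1)
proof (induction n arbitrary: f rule: dec_induct)
  case base
  then show ?case
    using affine_variety_extensional[OF affine] by simp
next
  case (step n)
  have "restrict f (X n) \<in> R n"
    using embedding[of n] step.prems unfolding closed_embedding_def by (auto simp: comp_def)
  then have "restrict (restrict f (X n)) (X m) \<in> R m"
    by (rule step.IH)
  then show ?case
    using X_mono[OF step.hyps(1)] by (metis restrict_restrict Int_absorb1)
qed

text \<open>
  Each restriction map \<open>R (Suc n) \<rightarrow> R n\<close> is onto because \<open>X n\<close> carries the induced structure of a
  closed subvariety; lifting step by step gives surjectivity of the projection from the limit.
\<close>

lemma ind_regular_extension:
  assumes h: "h \<in> R N"
  obtains F where "F \<in> ind_regular X R" "F N = h"
proof -
  have lift: "\<exists>g'. g' \<in> R (N + Suc n) \<and> restrict g' (X (N + n)) = g" if "g \<in> R (N + n)" for g n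
    using embedding[of "N + n"] that unfolding closed_embedding_def by (auto simp: comp_def)
  have "\<exists>G. (\<forall>n. G n \<in> R (N + n)) \<and> G 0 = h \<and> (\<forall>n. restrict (G (Suc n)) (X (N + n)) = G n)"
  proof -
    have "\<exists>G. \<forall>n. (G n \<in> R (N + n) \<and> (n = 0 \<longrightarrow> G n = h))
            \<and> restrict (G (Suc n)) (X (N + n)) = G n"
      using h lift by (intro dependent_nat_choice) fastforce+
    then show ?thesis by blast
  qed
  then obtain G where G: "\<And>n. G n \<in> R (N + n)" "G 0 = h"
      and compat: "\<And>n. restrict (G (Suc n)) (X (N + n)) = G n"
    by blast
  have G_Suc: "G (Suc n) x = G n x" if "x \<in> X (N + n)" for n x
    using that fun_cong[OF compat[of n], of x] by simp
  \<comment> \<open>\<open>G n\<close> lives on \<open>X (N + n)\<close>, which contains \<open>X n\<close>; cutting it down to \<open>X n\<close> also provides the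
      members of the family below \<open>N\<close>.\<close>
  define F where "F = (\<lambda>n. restrict (G n) (X n))"
  have "F \<in> ind_regular X R"
    unfolding ind_regular_def
  proof (intro CollectI allI conjI)
    fix n
    show "F n \<in> R n"
      unfolding F_def by (rule restrict_regular[OF G(1)]) simp
    show "restrict (F (Suc n)) (X n) = F n"
      using X_mono[of n "Suc n"] X_mono[of n "N + n"] G_Suc
      by (auto simp: F_def fun_eq_iff restrict_def)
  qed
  moreover have "F N = h"
  proof -
    have "G n x = h x" if "x \<in> X N" for n x
    proof (induction n)
      case (Suc n)
      have "x \<in> X (N + n)"
        using that X_mono[of N "N + n"] by auto
      then show ?case
        using G_Suc Suc by simp
    qed (simp add: G(2))
    then have "F N = restrict h (X N)"
      by (auto simp: F_def)
    then show ?thesis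
      using affine_variety_extensional[OF affine h] by simp
  qed
  ultimately show thesis
    by (rule that)
qed

text \<open>
  A function \<open>F\<close> supported in \<open>X N\<close> turns the local problem on \<open>X N\<close> into a global one: its product
  with any global extension of a function on \<open>X N\<close> is controlled everywhere.
\<close>

lemma separating_function:
  assumes Y: "ind_closed X R Y"
    and x: "x \<in> (\<Union>n. X n)" "x \<notin> Y"
    and F: "F \<in> ind_regular X R" "ind_value X F x \<noteq> 0"
    and supp: "\<And>y. y \<in> (\<Union>n. X n) \<Longrightarrow> ind_value X F y \<noteq> 0 \<Longrightarrow> y \<in> X N"
  obtains P where "P \<in> ind_regular X R" "\<forall>y\<in>Y. ind_value X P y = 0" "ind_value X P x \<noteq> 0"
proof -
  have xN: "x \<in> X N"
    using supp x(1) F(2) by blast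
  obtain E where E: "E \<subseteq> R N" "Y \<inter> X N = {y\<in>X N. \<forall>f\<in>E. f y = 0}"
    using Y unfolding ind_closed_def zariski_closed_def by blast
  then obtain h where h: "h \<in> R N" "h x \<noteq> 0" "\<And>y. y \<in> Y \<inter> X N \<Longrightarrow> h y = 0"
    using xN x(2) by blast
  obtain H where H: "H \<in> ind_regular X R" "H N = h"
    using ind_regular_extension[OF h(1)] by blast
  have H_N: "ind_value X H y = h y" if "y \<in> X N" for y
    using ind_value_eq[OF H(1) that] H(2) by simp
  define P where "P = (\<lambda>n. restrict (\<lambda>x. F n x * H n x) (X n))"
  have P: "P \<in> ind_regular X R"
    unfolding P_def by (rule ind_regular_mult[OF F(1) H(1)])
  have P_val: "ind_value X P y = ind_value X F y * ind_value X H y" if y: "y \<in> (\<Union>n. X n)" for y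
  proof -
    obtain n where "y \<in> X n" using y by blast
    then show ?thesis
      using P F(1) H(1) by (simp add: ind_value_eq[of _ y n]) (simp add: P_def)
  qed
  have "ind_value X P y = 0" if "y \<in> Y" for y
  proof -
    have y: "y \<in> (\<Union>n. X n)"
      using that Y unfolding ind_closed_def by blast
    show ?thesis
    proof (cases "y \<in> X N")
      case True
      then show ?thesis
        using that h(3) by (simp add: P_val[OF y] H_N)
    next
      case False
      then show ?thesis
        using supp[OF y] by (auto simp: P_val[OF y])
    qed
  qed
  moreover have "ind_value X P x \<noteq> 0"
    using F(2) h(2) by (simp add: P_val[OF x(1)] H_N[OF xN])
  ultimately show thesis
    using that P by blast
qed

lemma ind_closed_if_ind_zariski_closed:
  assumes "ind_zariski_closed X R Y"
  shows "ind_closed X R Y"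
proof -
  obtain E where E: "E \<subseteq> ind_regular X R" "Y = {x \<in> (\<Union>n. X n). \<forall>F\<in>E. ind_value X F x = 0}"
    using assms unfolding ind_zariski_closed_def by blast
  have "zariski_closed (X n) (R n) (Y \<inter> X n)" for n
    unfolding zariski_closed_def
  proof (intro exI conjI)
    show "(\<lambda>F. F n) ` E \<subseteq> R n"
      using E(1) unfolding ind_regular_def by blast
    have "ind_value X F x = F n x" if "F \<in> E" "x \<in> X n" for F x
      using ind_value_eq that E(1) by blast
    then show "Y \<inter> X n = {x\<in>X n. \<forall>f\<in>(\<lambda>F. F n) ` E. f x = 0}"
      unfolding E(2) by auto
  qed
  then show ?thesis
    unfolding ind_closed_def E(2) by blast
qed

text \<open>
  A Zariski open set contains a principal one around each of its points, and stationarity of the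
  former passes to the latter, bounding the support of its defining function.
\<close>

lemma stationary_neighbourhood_function:
  assumes U: "openin (zariski_topology X R) U" "x \<in> U"
    and stationary: "\<forall>\<^sub>F n in sequentially. U \<inter> X n = U \<inter> X (Suc n)"
  obtains F N where "F \<in> ind_regular X R" "ind_value X F x \<noteq> 0"
    "\<And>y. y \<in> (\<Union>n. X n) \<Longrightarrow> ind_value X F y \<noteq> 0 \<Longrightarrow> y \<in> X N"
proof -
  obtain E where E: "U \<subseteq> (\<Union>n. X n)" "E \<subseteq> ind_regular X R"
      "(\<Union>n. X n) - U = {y \<in> (\<Union>n. X n). \<forall>F\<in>E. ind_value X F y = 0}"
    using U(1) unfolding openin_zariski_topology ind_zariski_closed_def by auto
  then obtain F where F: "F \<in> E" "ind_value X F x \<noteq> 0"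
    using U(2) by blast
  obtain N where N: "\<And>n. n \<ge> N \<Longrightarrow> U \<inter> X n = U \<inter> X (Suc n)"
    using stationary unfolding eventually_sequentially by blast
  have const: "U \<inter> X n = U \<inter> X N" if "n \<ge> N" for n
    using that by (induction rule: dec_induct) (simp_all add: N[symmetric])
  have "y \<in> X N" if y: "y \<in> (\<Union>n. X n)" "ind_value X F y \<noteq> 0" for y
  proof -
    obtain n where "y \<in> X n"
      using y(1) by blast
    then have "y \<in> X (max n N)"
      using X_mono[of n "max n N"] by auto
    moreover have "y \<in> U"
      using E(3) F(1) y by blast
    ultimately show ?thesis
      using const[of "max n N"] by auto
  qed
  then show thesis
    using that F E(2) by blast
qed

end

theorem proposition3:
  fixes X :: "nat \<Rightarrow> 'x set" and R :: "nat \<Rightarrow> ('x \<Rightarrow> 'k::alg_closed_field) set"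
  assumes "uncountable (UNIV :: 'k set)"
    and "affine_ind_variety X R"
    and "\<forall>x\<in>\<Union>n. X n. \<exists>U. openin (zariski_topology X R) U \<and> x \<in> U \<and>
           (\<forall>\<^sub>F n in sequentially. U \<inter> X n = U \<inter> X (Suc n))"
  shows "ind_topology X R = zariski_topology X R"
proof -
  interpret affine_ind_variety X R by (rule assms(2))
  have "ind_zariski_closed X R Y" if Y: "ind_closed X R Y" for Y
    unfolding ind_zariski_closed_def
  proof (intro exI conjI)
    let ?I = "{F \<in> ind_regular X R. \<forall>y\<in>Y. ind_value X F y = 0}"
    show "?I \<subseteq> ind_regular X R" by blast
    have "x \<in> Y" if x: "x \<in> (\<Union>n. X n)" and vanish: "\<forall>F\<in>?I. ind_value X F x = 0" for x
    proof (rule ccontr)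
      assume "x \<notin> Y"
      obtain U where "openin (zariski_topology X R) U" "x \<in> U"
          "\<forall>\<^sub>F n in sequentially. U \<inter> X n = U \<inter> X (Suc n)"
        using assms(3) x by blast
      then obtain F N where F: "F \<in> ind_regular X R" "ind_value X F x \<noteq> 0"
          "\<And>y. y \<in> (\<Union>n. X n) \<Longrightarrow> ind_value X F y \<noteq> 0 \<Longrightarrow> y \<in> X N"
        by (rule stationary_neighbourhood_function) blast
      obtain P where "P \<in> ind_regular X R" "\<forall>y\<in>Y. ind_value X P y = 0" "ind_value X P x \<noteq> 0"
        by (rule separating_function[OF Y x \<open>x \<notin> Y\<close> F])
      then show False
        using vanish by blast
    qed
    moreover have "Y \<subseteq> (\<Union>n. X n)"
      using Y unfolding ind_closed_def by blast
    ultimately show "Y = {x \<in> (\<Union>n. X n). \<forall>F\<in>?I. ind_value X F x = 0}"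
      by blast
  qed
  then have "ind_closed X R Y \<longleftrightarrow> ind_zariski_closed X R Y" for Y
    using ind_closed_if_ind_zariski_closed by blast
  then show ?thesis
    unfolding topology_eq openin_ind_topology openin_zariski_topology by simp
qed

end
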